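(* A finite semilattice has Property (SDC) if and only if it is distributive. (A semilattice $\mathbb{M}=(M,\land)$ is said to have Property (SDC) if the clone $[\land]$ on $M$ has Property (SDC).)
   Context: Semilattices are meet semilattices, with order $x\le y\iff x\land y=x$. A meet semilattice $\mathbb{M}=(M,\land)$ is distributive if for any $a,b_0,b_1\in M$, the inequality $a\ge b_0\land b_1$ implies that there exist $a_0,a_1\in M$ such that $a_0\ge b_0$, $a_1\ge b_1$ and $a=a_0\land a_1$. Let $A$ be a finite set with at least two elements (the underlying sets of the algebras considered are of this kind). An operation on $A$ is a map $f\colon A^n\to A$, where the arity $n$ is a positive integer; $\mathcal{O}_A$ is the set of all operations on $A$, and $F^{(n)}$ is the set of $n$-ary members of $F\subseteq\mathcal{O}_A$. A clone on $A$ is a set $C\subseteq\mathcal{O}_A$ that contains all projections and is closed under composition; $[F]$ is the least clone containing $F$ (the set of term operations of the algebra $(A,F)$). Operations $f\in\mathcal{O}_A^{(n)}$ and $g\in\mathcal{O}_A^{(m)}$ commute if $f(g(a_{11},\dots,a_{1m}),\dots,g(a_{n1},\dots,a_{nm}))=g(f(a_{11},\dots,a_{n1}),\dots,f(a_{1m},\dots,a_{nm}))$ for all $a_{ij}\in A$. The centralizer of $F\subseteq\mathcal{O}_A$ is $F^{\ast}=\{g\in\mathcal{O}_A : g \text{ commutes with every } f\in F\}$. A set $T\subseteq A^n$ is closed under a clone $D$ if for all $m\in\mathbb{N}$, $\mathbf{t}^{(1)},\dots,\mathbf{t}^{(m)}\in T$ and $f\in D^{(m)}$, the tuple obtained by applying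 $f$ componentwise to $\mathbf{t}^{(1)},\dots,\mathbf{t}^{(m)}$ is in $T$. For a clone $C$ on $A$, a system of $C$-equations is a finite set $\mathcal{E}=\{(f_1,g_1),\dots,(f_t,g_t)\}$ with $f_i,g_i\in C^{(n)}$ (all of the same arity $n$), and $\operatorname{Sol}(\mathcal{E})=\{\mathbf{a}\in A^n : f_i(\mathbf{a})=g_i(\mathbf{a}) \text{ for } i=1,\dots,t\}$. The clone $C$ has Property (SDC) if for all $n\in\mathbb{N}$ and all $T\subseteq A^n$ the following are equivalent: (a) there exists a system $\mathcal{E}$ of $C$-equations such that $T=\operatorname{Sol}(\mathcal{E})$; (b) the set $T$ is closed under $C^{\ast}$.
   Formalization: In Property (SDC), T ranges over the nonempty subsets of A^n with n ≥ 1: the empty set is vacuously closed under C* (arities are positive) but is never a solution set over the idempotent clone [∧], so with T empty allowed no semilattice would have (SDC). *)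

theory Defs
  imports "HOL-Library.FuncSet" "HOL-Library.Cardinality"
begin

text \<open>
  The underlying set of the algebras is the universe of a finite type \<open>'a\<close>; an element of
  $A^n$ is a list of length \<open>n\<close>.
\<close>

definition tuples :: "nat \<Rightarrow> 'a list set" where
  "tuples n = {xs. length xs = n}"

text \<open>
  An operation is stored together with its arity. Its function part is extensional on
  \<open>tuples n\<close>, so that equality of operations is equality of maps $A^n \to A$.
\<close>

type_synonym 'a oper = "nat \<times> ('a list \<Rightarrow> 'a)"

definition operations :: "'a oper set" where
  "operations = {(n, f). 1 \<le> n \<and> f \<in> extensional (tuples n)}"

definition n_ary :: "'a oper set \<Rightarrow> nat \<Rightarrow> ('a list \<Rightarrow> 'a) set" where
  "n_ary F n = {f. (n, f) \<in> F}"

definition projection :: "nat \<Rightarrow> nat \<Rightarrow> 'a oper" where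
  "projection n i = (n, restrict (\<lambda>xs. xs ! i) (tuples n))"

text \<open>\<open>f\<close> has arity \<open>length gs\<close>, and all members of \<open>gs\<close> have arity \<open>m\<close>.\<close>

definition composition :: "nat \<Rightarrow> ('a list \<Rightarrow> 'a) \<Rightarrow> ('a list \<Rightarrow> 'a) list \<Rightarrow> 'a oper" where
  "composition m f gs = (m, restrict (\<lambda>xs. f (map (\<lambda>g. g xs) gs)) (tuples m))"

definition is_clone :: "'a oper set \<Rightarrow> bool" where
  "is_clone C \<longleftrightarrow>
     C \<subseteq> operations \<and>
     (\<forall>n i. i < n \<longrightarrow> projection n i \<in> C) \<and>
     (\<forall>n m f gs. f \<in> n_ary C n \<and> length gs = n \<and> set gs \<subseteq> n_ary C m \<longrightarrow> composition m f gs \<in> C)"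

definition generated_clone :: "'a oper set \<Rightarrow> 'a oper set" where
  "generated_clone F = \<Inter>{C. is_clone C \<and> F \<subseteq> C}"

definition commute :: "'a oper \<Rightarrow> 'a oper \<Rightarrow> bool" where
  "commute = (\<lambda>(n, f) (m, g). \<forall>a :: nat \<Rightarrow> nat \<Rightarrow> 'a.
     f (map (\<lambda>i. g (map (\<lambda>j. a i j) [0..<m])) [0..<n]) =
     g (map (\<lambda>j. f (map (\<lambda>i. a i j) [0..<n])) [0..<m]))"

definition centralizer :: "'a oper set \<Rightarrow> 'a oper set" where
  "centralizer F = {g \<in> operations. \<forall>f\<in>F. commute f g}"

definition closed_under :: "nat \<Rightarrow> 'a list set \<Rightarrow> 'a oper set \<Rightarrow> bool" where
  "closed_under n T D \<longleftrightarrow>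
     (\<forall>m f ts. f \<in> n_ary D m \<and> length ts = m \<and> set ts \<subseteq> T \<longrightarrow>
        map (\<lambda>i. f (map (\<lambda>t. t ! i) ts)) [0..<n] \<in> T)"

definition equation_system ::
    "'a oper set \<Rightarrow> nat \<Rightarrow> (('a list \<Rightarrow> 'a) \<times> ('a list \<Rightarrow> 'a)) set \<Rightarrow> bool" where
  "equation_system C n E \<longleftrightarrow> finite E \<and> E \<subseteq> n_ary C n \<times> n_ary C n"

definition Sol :: "nat \<Rightarrow> (('a list \<Rightarrow> 'a) \<times> ('a list \<Rightarrow> 'a)) set \<Rightarrow> 'a list set" where
  "Sol n E = {a \<in> tuples n. \<forall>(f, g)\<in>E. f a = g a}"

text \<open>
  The arity \<open>n\<close> is positive, as operations have positive arity. The set \<open>T\<close> ranges over the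
  nonempty subsets of $A^n$: since there are no nullary operations, the empty set is closed under
  every clone, whereas systems of equations over an idempotent clone (such as the clone of a
  semilattice) are always solvable, so no semilattice would satisfy the equivalence for the
  empty set.
\<close>

definition SDC :: "'a oper set \<Rightarrow> bool" where
  "SDC C \<longleftrightarrow>
     (\<forall>n\<ge>1. \<forall>T. T \<subseteq> tuples n \<and> T \<noteq> {} \<longrightarrow>
        ((\<exists>E. equation_system C n E \<and> T = Sol n E) \<longleftrightarrow> closed_under n T (centralizer C)))"

definition binary_oper :: "('a \<Rightarrow> 'a \<Rightarrow> 'a) \<Rightarrow> 'a oper" where
  "binary_oper h = (2, restrict (\<lambda>xs. h (xs ! 0) (xs ! 1)) (tuples 2))"

definition semilattice_SDC :: "('a \<Rightarrow> 'a \<Rightarrow> 'a) \<Rightarrow> bool" where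
  "semilattice_SDC meet \<longleftrightarrow> SDC (generated_clone {binary_oper meet})"

definition meet_le :: "('a \<Rightarrow> 'a \<Rightarrow> 'a) \<Rightarrow> 'a \<Rightarrow> 'a \<Rightarrow> bool" where
  "meet_le meet x y \<longleftrightarrow> meet x y = x"

definition distributive_semilattice :: "('a \<Rightarrow> 'a \<Rightarrow> 'a) \<Rightarrow> bool" where
  "distributive_semilattice meet \<longleftrightarrow>
     (\<forall>a b0 b1. meet_le meet (meet b0 b1) a \<longrightarrow>
        (\<exists>a0 a1. meet_le meet b0 a0 \<and> meet_le meet b1 a1 \<and> a = meet a0 a1))"

end

theory Submission
  imports Defs
begin

text \<open>
  The centralizer of the clone of a semilattice $M$ consists of the homomorphisms $M^m \to M$, so
  (SDC) says that every homomorphism from a subsemilattice of $M^m$ to $M$ extends to $M^m$.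
  A finite distributive semilattice is a distributive lattice, and the extension is given by
  joins from below. Conversely, choose $b < c$ in $M$ with $b$ the least element. Extending the inverse
  of the embedding of $M$ into $M^M$ whose image of $x$ has $y$-th entry $c$ if $y \le x$ and $b$
  otherwise gives a retraction of $M^M$ onto $M$. If $a \ge b_0 \wedge b_1$, then the retraction
  maps the joins of the images of $a$ and $b_i$, taken in the Boolean lattice $\{b,c\}^M$, to the
  required factors of $a$.
\<close>

section \<open>Commutation, clones and centralizers\<close>

lemma map_nth_upt: "map (\<lambda>j. h (xs ! j)) [0..<length xs] = map h xs"
  by (rule nth_equalityI) auto

text \<open>Brings \<open>commute\<close> into the shape of \<open>closed_under\<close>: in the
  matrix with entries \<open>ts ! j ! i\<close> the columns are the given tuples, so applying
  \<open>f\<close> along the rows yields their componentwise image.\<close>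

lemma commute_tuples:
  assumes "commute (n, p) (m, f)" "length ts = m" "set ts \<subseteq> tuples n"
  shows "p (map (\<lambda>i. f (map (\<lambda>t. t ! i) ts)) [0..<n]) = f (map p ts)"
proof -
  have "p (map (\<lambda>i. f (map (\<lambda>j. ts ! j ! i) [0..<m])) [0..<n]) =
        f (map (\<lambda>j. p (map (\<lambda>i. ts ! j ! i) [0..<n])) [0..<m])"
    using assms(1)[unfolded commute_def prod.case, rule_format, of "\<lambda>i j. ts ! j ! i"] .
  moreover have "map (\<lambda>j. ts ! j ! i) [0..<m] = map (\<lambda>t. t ! i) ts" for i
    using map_nth_upt[of "\<lambda>t. t ! i" ts] assms(2) by simp
  moreover have "map (\<lambda>j. p (map (\<lambda>i. ts ! j ! i) [0..<n])) [0..<m] = map p ts"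
  proof (rule nth_equalityI)
    fix j assume "j < length (map (\<lambda>j. p (map (\<lambda>i. ts ! j ! i) [0..<n])) [0..<m])"
    then have j: "j < length ts"
      by (simp add: assms(2))
    then have "length (ts ! j) = n"
      using assms(3) nth_mem by (auto simp: tuples_def)
    then have "map ((!) (ts ! j)) [0..<n] = ts ! j"
      using map_nth by blast
    then show "map (\<lambda>j. p (map (\<lambda>i. ts ! j ! i) [0..<n])) [0..<m] ! j = map p ts ! j"
      using j assms(2) by simp
  qed (simp add: assms(2))
  ultimately show ?thesis
    by simp
qed

text \<open>Used with \<open>G\<close> empty to see that \<open>operations\<close> is a clone, and
  with \<open>G\<close> a centralizer to see that a bicentralizer is one.\<close>

lemma is_clone_commutant:
  fixes G :: "'a oper set"
  shows "is_clone {f \<in> operations. \<forall>g\<in>G. commute f g}" (is "is_clone ?C")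
  unfolding is_clone_def
proof (intro conjI allI impI)
  show "?C \<subseteq> operations"
    by blast
next
  fix n i :: nat
  assume i: "i < n"
  have "commute (projection n i) g" for g :: "'a oper"
    using i by (cases g) (simp add: commute_def projection_def tuples_def)
  moreover have "projection n i \<in> operations"
    using i by (auto simp: projection_def operations_def)
  ultimately show "projection n i \<in> ?C"
    by blast
next
  fix n m f gs
  assume a: "f \<in> n_ary ?C n \<and> length gs = n \<and> set gs \<subseteq> n_ary ?C m"
  \<comment> \<open>Since \<open>f\<close> has positive arity, \<open>gs\<close> has a member, and
    that member forces \<open>m\<close> to be positive too.\<close>
  then have "gs \<noteq> []"
    by (auto simp: n_ary_def operations_def)
  with a have "1 \<le> m"
    by (cases gs) (auto simp: n_ary_def operations_def)
  then have "composition m f gs \<in> operations"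
    by (auto simp: composition_def operations_def)
  moreover have "commute (composition m f gs) (k, h)" if h: "(k, h) \<in> G" for k h
    unfolding commute_def composition_def prod.case
  proof (intro allI)
    fix a :: "nat \<Rightarrow> nat \<Rightarrow> 'a"
    \<comment> \<open>The matrix of inner values: \<open>h\<close> first passes through each member
      of \<open>gs\<close> on \<open>a\<close>, then through \<open>f\<close> on
      \<open>?b\<close>.\<close>
    let ?b = "\<lambda>p j. (gs ! p) (map (\<lambda>i. a i j) [0..<m])"
    have g: "g (map (\<lambda>i. h (map (a i) [0..<k])) [0..<m]) =
        h (map (\<lambda>j. g (map (\<lambda>i. a i j) [0..<m])) [0..<k])" if "g \<in> set gs" for g
    proof -
      have "commute (m, g) (k, h)"
        using that a h by (auto simp: n_ary_def)
      then show ?thesis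
        by (simp add: commute_def)
    qed
    have f: "commute (n, f) (k, h)"
      using a h by (auto simp: n_ary_def)
    have gs: "map (\<lambda>p. r (gs ! p)) [0..<n] = map r gs" for r :: "_ \<Rightarrow> 'a"
      using map_nth_upt[of r gs] a by simp
    have "restrict (\<lambda>xs. f (map (\<lambda>g. g xs) gs)) (tuples m)
            (map (\<lambda>i. h (map (a i) [0..<k])) [0..<m]) =
          f (map (\<lambda>g. h (map (\<lambda>j. g (map (\<lambda>i. a i j) [0..<m])) [0..<k])) gs)"
      using g by (simp add: tuples_def cong: map_cong)
    also have "\<dots> = f (map (\<lambda>p. h (map (\<lambda>j. ?b p j) [0..<k])) [0..<n])"
      by (subst gs) simp
    also have "\<dots> = h (map (\<lambda>j. f (map (\<lambda>p. ?b p j) [0..<n])) [0..<k])"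
      using f[unfolded commute_def prod.case, rule_format, of ?b] .
    also have "\<dots> = h (map (\<lambda>j. restrict (\<lambda>xs. f (map (\<lambda>g. g xs) gs)) (tuples m)
            (map (\<lambda>i. a i j) [0..<m])) [0..<k])"
      by (subst gs) (simp add: tuples_def)
    finally show "restrict (\<lambda>xs. f (map (\<lambda>g. g xs) gs)) (tuples m)
            (map (\<lambda>i. h (map (a i) [0..<k])) [0..<m]) =
          h (map (\<lambda>j. restrict (\<lambda>xs. f (map (\<lambda>g. g xs) gs)) (tuples m)
            (map (\<lambda>i. a i j) [0..<m])) [0..<k])" .
  qed
  ultimately show "composition m f gs \<in> ?C"
    by auto
qed

lemma is_clone_operations: "is_clone operations"
  using is_clone_commutant[of "{}"] by simp

lemma generated_clone_superset: "F \<subseteq> generated_clone F"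
  by (auto simp: generated_clone_def)

lemma generated_clone_least: "is_clone C \<Longrightarrow> F \<subseteq> C \<Longrightarrow> generated_clone F \<subseteq> C"
  by (auto simp: generated_clone_def)

text \<open>The hypothesis makes \<open>operations\<close> a member of the family being intersected,
  so the intersection stays within \<open>operations\<close>.\<close>

lemma is_clone_generated_clone:
  assumes "F \<subseteq> operations"
  shows "is_clone (generated_clone F)"
proof -
  have "generated_clone F \<subseteq> operations"
    using assms is_clone_operations by (rule generated_clone_least[rotated])
  moreover have "projection n i \<in> generated_clone F" if "i < n" for n i
    using that by (auto simp: generated_clone_def is_clone_def)
  moreover have "composition m f gs \<in> generated_clone F"
    if a: "f \<in> n_ary (generated_clone F) n" "length gs = n" "set gs \<subseteq> n_ary (generated_clone F) m"
    for n m f gs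
    unfolding generated_clone_def
  proof
    fix C assume C: "C \<in> {C. is_clone C \<and> F \<subseteq> C}"
    then have "n_ary (generated_clone F) k \<subseteq> n_ary C k" for k
      using generated_clone_least[of C F] by (auto simp: n_ary_def)
    with a have "f \<in> n_ary C n" "set gs \<subseteq> n_ary C m"
      by blast+
    with C a(2) show "composition m f gs \<in> C"
      by (auto simp: is_clone_def)
  qed
  ultimately show ?thesis
    by (auto simp: is_clone_def)
qed

lemma centralizer_generated_clone:
  assumes "F \<subseteq> operations"
  shows "centralizer (generated_clone F) = centralizer F"
proof
  show "centralizer (generated_clone F) \<subseteq> centralizer F"
    using generated_clone_superset[of F] by (auto simp: centralizer_def)
  \<comment> \<open>The right-hand side is the bicentralizer of \<open>F\<close>, a clone containing
    \<open>F\<close>. Writing it with \<open>f\<close> as first argument of \<open>commute\<close>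
    avoids any appeal to symmetry.\<close>
  have "generated_clone F \<subseteq> {f \<in> operations. \<forall>g\<in>centralizer F. commute f g}"
    using assms by (intro generated_clone_least is_clone_commutant) (auto simp: centralizer_def)
  then show "centralizer F \<subseteq> centralizer (generated_clone F)"
    by (auto simp: centralizer_def)
qed

text \<open>The half of (SDC) valid for every \<open>C\<close>: by commutation, both sides of an
  equation at the new tuple equal \<open>f\<close> applied to their common values on
  \<open>ts\<close>.\<close>

lemma closed_under_Sol:
  assumes "equation_system C n E"
  shows "closed_under n (Sol n E) (centralizer C)"
  unfolding closed_under_def
proof (intro allI impI)
  fix m f ts
  assume a: "f \<in> n_ary (centralizer C) m \<and> length ts = m \<and> set ts \<subseteq> Sol n E"
  let ?t = "map (\<lambda>i. f (map (\<lambda>t. t ! i) ts)) [0..<n]"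
  have ts: "set ts \<subseteq> tuples n"
    using a by (auto simp: Sol_def)
  have "p ?t = q ?t" if pq: "(p, q) \<in> E" for p q
  proof -
    have "commute (n, p) (m, f)" "commute (n, q) (m, f)"
      using pq a assms by (auto simp: equation_system_def n_ary_def centralizer_def)
    then have "p ?t = f (map p ts)" "q ?t = f (map q ts)"
      using a ts by (simp_all add: commute_tuples)
    moreover have "map p ts = map q ts"
      using a pq by (auto simp: Sol_def)
    ultimately show ?thesis
      by simp
  qed
  then show "?t \<in> Sol n E"
    by (auto simp: Sol_def tuples_def)
qed

lemma finite_n_ary:
  assumes "C \<subseteq> (operations :: 'a::finite oper set)"
  shows "finite (n_ary C n)"
proof (rule finite_subset)
  show "n_ary C n \<subseteq> (\<Pi>\<^sub>E xs\<in>tuples n. UNIV)"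
    using assms by (auto simp: n_ary_def operations_def PiE_def)
  have "finite (tuples n :: 'a list set)"
    using finite_lists_length_eq[of "UNIV :: 'a set" n] by (simp add: tuples_def)
  then show "finite (\<Pi>\<^sub>E xs\<in>(tuples n :: 'a list set). (UNIV :: 'a set))"
    by (intro finite_PiE) auto
qed

section \<open>Operations commuting with a binary operation\<close>

lemma binary_oper_in_operations: "binary_oper h \<in> operations"
  by (auto simp: binary_oper_def operations_def)

text \<open>Extensionality is left out, so that homomorphisms can be built as plain functions and
  cut down by \<open>restrict\<close> only when they must be operations.\<close>

definition preserves :: "('a \<Rightarrow> 'a \<Rightarrow> 'a) \<Rightarrow> nat \<Rightarrow> ('a list \<Rightarrow> 'a) \<Rightarrow> bool" where
  "preserves h m f \<longleftrightarrow>
     (\<forall>xs\<in>tuples m. \<forall>ys\<in>tuples m. f (map2 h xs ys) = h (f xs) (f ys))"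

lemma preservesD:
  "preserves h m f \<Longrightarrow> length xs = m \<Longrightarrow> length ys = m \<Longrightarrow> f (map2 h xs ys) = h (f xs) (f ys)"
  by (simp add: preserves_def tuples_def)

lemma commute_binary_oper: "commute (binary_oper h) (m, f) \<longleftrightarrow> preserves h m f"
proof -
  have map2: "map2 h (map r [0..<m]) (map s [0..<m]) = map (\<lambda>j. h (r j) (s j)) [0..<m]" for r s
    by (rule nth_equalityI) auto
  have "commute (binary_oper h) (m, f) \<longleftrightarrow>
      (\<forall>a :: nat \<Rightarrow> nat \<Rightarrow> 'a. h (f (map (a 0) [0..<m])) (f (map (a 1) [0..<m])) =
         f (map (\<lambda>j. h (a 0 j) (a 1 j)) [0..<m]))"
    by (simp add: commute_def binary_oper_def tuples_def numeral_2_eq_2)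
  also have "\<dots> \<longleftrightarrow> preserves h m f"
    (is "?L \<longleftrightarrow> ?R")
  proof
    assume L: ?L
    show ?R
      unfolding preserves_def
    proof (intro ballI)
      fix xs ys :: "'a list"
      assume "xs \<in> tuples m" "ys \<in> tuples m"
      then have e: "map ((!) xs) [0..<m] = xs" "map ((!) ys) [0..<m] = ys"
        using map_nth[of xs] map_nth[of ys] by (auto simp: tuples_def)
      show "f (map2 h xs ys) = h (f xs) (f ys)"
        using L[rule_format, of "\<lambda>i. if i = 0 then (!) xs else (!) ys"] map2[of "(!) xs" "(!) ys"]
        by (simp add: e)
    qed
  next
    assume ?R
    then show ?L
      by (simp add: preserves_def tuples_def flip: map2)
  qed
  finally show ?thesis .
qed

lemma n_ary_centralizer_binary_oper:
  "f \<in> n_ary (centralizer (generated_clone {binary_oper h})) m \<longleftrightarrow>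
     1 \<le> m \<and> f \<in> extensional (tuples m) \<and> preserves h m f"
  using centralizer_generated_clone[of "{binary_oper h}"] binary_oper_in_operations[of h]
  by (simp add: n_ary_def centralizer_def commute_binary_oper operations_def)

lemma preserves_restrict:
  "preserves h m f \<Longrightarrow> preserves h m (restrict f (tuples m))"
  by (simp add: preserves_def tuples_def)

section \<open>Joins and distributivity in a finite semilattice\<close>

locale finite_semilattice = semilattice meet
  for meet :: "'a::finite \<Rightarrow> 'a \<Rightarrow> 'a"  (infixl \<open>\<sqinter>\<close> 70)
begin

abbreviation le (infix \<open>\<sqsubseteq>\<close> 50) where "x \<sqsubseteq> y \<equiv> meet_le meet x y"

sublocale semilattice_order meet "meet_le meet" "\<lambda>x y. x \<sqsubseteq> y \<and> x \<noteq> y"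
  by unfold_locales (auto simp: meet_le_def)

abbreviation "terms \<equiv> n_ary (generated_clone {binary_oper meet})"

text \<open>Finite meets of members of \<open>U\<close> stay in \<open>U\<close>, and
  \<open>U\<close> itself is finite.\<close>

lemma directed_least:
  assumes "U \<noteq> {}" and "\<And>x y. x \<in> U \<Longrightarrow> y \<in> U \<Longrightarrow> x \<sqinter> y \<in> U"
  shows "\<exists>z\<in>U. \<forall>x\<in>U. z \<sqsubseteq> x"
proof -
  have "\<exists>z\<in>U. \<forall>x\<in>F. z \<sqsubseteq> x" if "finite F" "F \<noteq> {}" "F \<subseteq> U" for F
    using that
  proof (induction F rule: finite_ne_induct)
    case (singleton x)
    then show ?case
      using refl by auto
  next
    case (insert x F)
    then obtain z where "z \<in> U" "\<forall>y\<in>F. z \<sqsubseteq> y"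
      by auto
    then show ?case
      using insert.prems assms(2) by (intro bexI[of _ "x \<sqinter> z"]) (auto intro: coboundedI1 coboundedI2)
  qed
  then show ?thesis
    using assms(1) by auto
qed

lemma bottom_exists: "\<exists>z. \<forall>x. z \<sqsubseteq> x"
  using directed_least[of UNIV] by auto

text \<open>A relation, since joins may fail to exist. Taking \<open>u = z\<close> in the
  equivalence shows that \<open>z\<close> is an upper bound; for empty \<open>S\<close> it says that
  \<open>z\<close> is the bottom.\<close>

definition is_lub :: "'a set \<Rightarrow> 'a \<Rightarrow> bool" where
  "is_lub S z \<longleftrightarrow> (\<forall>u. z \<sqsubseteq> u \<longleftrightarrow> (\<forall>s\<in>S. s \<sqsubseteq> u))"

lemma is_lub_upper: "is_lub S z \<Longrightarrow> s \<in> S \<Longrightarrow> s \<sqsubseteq> z"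
  using refl by (auto simp: is_lub_def)

lemma is_lub_insert:
  "is_lub S z \<Longrightarrow> is_lub {s, z} w \<Longrightarrow> is_lub (insert s S) w"
  by (auto simp: is_lub_def)

lemma is_lub_unique: "is_lub S z \<Longrightarrow> is_lub S w \<Longrightarrow> z = w"
  using refl antisym unfolding is_lub_def by metis

text \<open>Splitting \<open>x\<close> over \<open>x \<sqinter> y\<close> gives a factor
  \<open>a1\<close> above both \<open>x\<close> and \<open>y\<close>. The common upper bounds are
  thus nonempty and closed under meets, so they have a least member.\<close>

lemma binary_lub_exists:
  assumes "distributive_semilattice meet"
  shows "\<exists>z. is_lub {x, y} z"
proof -
  have "x \<sqinter> y \<sqsubseteq> x"
    by (rule cobounded1)
  then obtain a0 a1 where "y \<sqsubseteq> a1" "x = a0 \<sqinter> a1"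
    using assms unfolding distributive_semilattice_def by blast
  then have "a1 \<in> {u. x \<sqsubseteq> u \<and> y \<sqsubseteq> u}"
    by simp
  then obtain z where "x \<sqsubseteq> z" "y \<sqsubseteq> z" "\<And>u. x \<sqsubseteq> u \<Longrightarrow> y \<sqsubseteq> u \<Longrightarrow> z \<sqsubseteq> u"
    using directed_least[of "{u. x \<sqsubseteq> u \<and> y \<sqsubseteq> u}"] by auto
  then show ?thesis
    unfolding is_lub_def using trans by blast
qed

lemma lub_exists:
  assumes "distributive_semilattice meet"
  shows "\<exists>z. is_lub S z"
proof -
  have "finite S"
    by simp
  then show ?thesis
  proof induction
    case empty
    then show ?case
      using bottom_exists by (auto simp: is_lub_def)
  next
    case (insert s S)
    then obtain z where "is_lub S z"
      by blast
    then show ?case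
      using is_lub_insert binary_lub_exists[OF assms] by blast
  qed
qed

text \<open>The lattice distributive law in the form of an inequality with arbitrary bound
  \<open>u\<close>. It follows from two uses of \<open>split\<close>, first over the join of
  \<open>u\<close> and \<open>d\<close>, then over \<open>u\<close>.\<close>

lemma binary_lub_meet_le:
  assumes D: "distributive_semilattice meet"
    and z: "is_lub {d, e} z" and d: "d \<sqinter> c \<sqsubseteq> u" and e: "e \<sqinter> c \<sqsubseteq> u"
  shows "z \<sqinter> c \<sqsubseteq> u"
proof -
  \<comment> \<open>Both factors of \<open>x = a0 \<sqinter> a1\<close> lie above \<open>x\<close>,
    so \<open>a0\<close> bounds the join of \<open>x\<close> and \<open>y\<close>, and
    \<open>a1\<close> bounds the join of \<open>x\<close> and \<open>c\<close>.\<close>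
  have split: "\<exists>v. is_lub {x, y} v \<and> v \<sqinter> w \<sqsubseteq> x"
    if "y \<sqinter> c \<sqsubseteq> x" "is_lub {x, c} w" for x y w
  proof -
    obtain v where v: "is_lub {x, y} v"
      using binary_lub_exists[OF D] by blast
    obtain a0 a1 where a: "y \<sqsubseteq> a0" "c \<sqsubseteq> a1" "x = a0 \<sqinter> a1"
      using D \<open>y \<sqinter> c \<sqsubseteq> x\<close> unfolding distributive_semilattice_def by blast
    then have "v \<sqsubseteq> a0" "w \<sqsubseteq> a1"
      using v that(2) by (auto simp: is_lub_def)
    then show ?thesis
      using v a(3) mono by blast
  qed
  obtain p where p: "is_lub {u, d} p"
    using binary_lub_exists[OF D] by blast
  have "u \<sqsubseteq> p" "d \<sqsubseteq> p"
    using is_lub_upper[OF p] by auto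
  obtain t where t: "is_lub {p, c} t"
    using binary_lub_exists[OF D] by blast
  have "e \<sqinter> c \<sqsubseteq> p"
    using e \<open>u \<sqsubseteq> p\<close> trans by blast
  then obtain v where v: "is_lub {p, e} v" "v \<sqinter> t \<sqsubseteq> p"
    using split t by blast
  have "z \<sqsubseteq> v"
    using z is_lub_upper[OF v(1)] \<open>d \<sqsubseteq> p\<close> trans[of d p v] by (auto simp: is_lub_def)
  moreover have "c \<sqsubseteq> t"
    using is_lub_upper[OF t] by simp
  ultimately have zc: "z \<sqinter> c \<sqsubseteq> p"
    using v(2) mono trans by blast
  \<comment> \<open>The second use of \<open>split\<close> descends from \<open>p\<close>, the join
    of \<open>u\<close> and \<open>d\<close>, to \<open>u\<close>.\<close>
  obtain s where s: "is_lub {u, c} s"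
    using binary_lub_exists[OF D] by blast
  then obtain p' where "is_lub {u, d} p'" "p' \<sqinter> s \<sqsubseteq> u"
    using split d by blast
  then have "p \<sqinter> s \<sqsubseteq> u"
    using is_lub_unique p by blast
  moreover have "z \<sqinter> c \<sqsubseteq> s"
    using is_lub_upper[OF s] coboundedI2 by simp
  ultimately show ?thesis
    using zc trans boundedI by blast
qed

lemma lub_meet_le:
  assumes D: "distributive_semilattice meet"
  shows "is_lub S z \<Longrightarrow> (\<And>s. s \<in> S \<Longrightarrow> s \<sqinter> c \<sqsubseteq> u) \<Longrightarrow> z \<sqinter> c \<sqsubseteq> u"
proof -
  have "finite S"
    by simp
  then show "is_lub S z \<Longrightarrow> (\<And>s. s \<in> S \<Longrightarrow> s \<sqinter> c \<sqsubseteq> u) \<Longrightarrow> z \<sqinter> c \<sqsubseteq> u"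
  proof (induction arbitrary: z)
    case empty
    then show ?case
      by (auto simp: is_lub_def intro: coboundedI1)
  next
    case (insert s S)
    obtain w where w: "is_lub S w"
      using lub_exists[OF D] by blast
    then have "w \<sqinter> c \<sqsubseteq> u"
      using insert by blast
    obtain z' where z': "is_lub {s, w} z'"
      using binary_lub_exists[OF D] by blast
    then have "z = z'"
      using is_lub_insert[OF w] is_lub_unique insert.prems(1) by blast
    then show ?case
      using binary_lub_meet_le[OF D z'] \<open>w \<sqinter> c \<sqsubseteq> u\<close> insert.prems(2) by simp
  qed
qed

text \<open>Distributes over one join at a time. This is what makes extension by joins from below
  compatible with meets.\<close>

lemma lub_meet_lub_le:
  assumes D: "distributive_semilattice meet"
    and "is_lub S z" "is_lub S' z'"
    and st: "\<And>s t. s \<in> S \<Longrightarrow> t \<in> S' \<Longrightarrow> s \<sqinter> t \<sqsubseteq> u"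
  shows "z \<sqinter> z' \<sqsubseteq> u"
proof (rule lub_meet_le[OF D \<open>is_lub S z\<close>])
  fix s assume "s \<in> S"
  then have "z' \<sqinter> s \<sqsubseteq> u"
    using st by (intro lub_meet_le[OF D \<open>is_lub S' z'\<close>]) (metis commute)
  then show "s \<sqinter> z' \<sqsubseteq> u"
    by (simp add: commute)
qed

section \<open>From distributivity to (SDC)\<close>

lemma is_clone_terms: "is_clone (generated_clone {binary_oper meet})"
  using is_clone_generated_clone binary_oper_in_operations by blast

lemma projection_in_terms: "i < n \<Longrightarrow> restrict (\<lambda>xs. xs ! i) (tuples n) \<in> terms n"
  using is_clone_terms by (auto simp: is_clone_def projection_def n_ary_def)

lemma meet_in_terms:
  assumes "p \<in> terms n" "q \<in> terms n"
  shows "restrict (\<lambda>xs. p xs \<sqinter> q xs) (tuples n) \<in> terms n"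
proof -
  let ?f = "restrict (\<lambda>xs. xs ! 0 \<sqinter> xs ! 1) (tuples 2)"
  have "?f \<in> terms 2"
    using generated_clone_superset[of "{binary_oper meet}"] by (auto simp: n_ary_def binary_oper_def)
  moreover have "length [p, q] = 2" "set [p, q] \<subseteq> terms n"
    using assms by auto
  ultimately have "composition n ?f [p, q] \<in> generated_clone {binary_oper meet}"
    using is_clone_terms unfolding is_clone_def by blast
  then show ?thesis
    by (simp add: composition_def tuples_def n_ary_def)
qed

text \<open>
  A tuple \<open>a\<close> satisfying all equations valid in the tuples \<open>ts\<close> induces a homomorphism on the
  subsemilattice of \<open>'a\<^sup>m\<close> generated by the rows of the matrix with columns \<open>ts\<close>, sending
  the \<open>i\<close>-th row to \<open>a ! i\<close>. It is extended to all of \<open>'a\<^sup>m\<close> by joins from below.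
\<close>

lemma homomorphism_extension:
  assumes D: "distributive_semilattice meet"
    and ts: "set ts \<subseteq> tuples n" and a: "a \<in> tuples n"
    and eqs: "\<And>p q. p \<in> terms n \<Longrightarrow> q \<in> terms n \<Longrightarrow> (\<And>t. t \<in> set ts \<Longrightarrow> p t = q t) \<Longrightarrow> p a = q a"
  shows "\<exists>f. preserves meet (length ts) f \<and> (\<forall>i<n. f (map (\<lambda>t. t ! i) ts) = a ! i)"
proof -
  let ?m = "length ts"
  \<comment> \<open>A term \<open>p\<close> represents the tuple with entries
    \<open>p (ts ! j)\<close>; the homomorphism being extended sends this tuple to
    \<open>p a\<close>, and \<open>eqs\<close> makes the value independent of
    \<open>p\<close>.\<close>
  define below where "below x = {p \<in> terms n. \<forall>j<?m. p (ts ! j) \<sqsubseteq> x ! j}" for x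
  have "\<forall>x. \<exists>z. is_lub ((\<lambda>p. p a) ` below x) z"
    using lub_exists[OF D] by blast
  then obtain f where f: "\<And>x. is_lub ((\<lambda>p. p a) ` below x) (f x)"
    by metis
  have tn: "ts ! j \<in> tuples n" if "j < ?m" for j
    using ts that nth_mem by blast
  have f_le: "f x \<sqsubseteq> u" if "\<And>p. p \<in> below x \<Longrightarrow> p a \<sqsubseteq> u" for x u
    using f[of x] that by (auto simp: is_lub_def)
  have le_f: "p a \<sqsubseteq> f x" if "p \<in> below x" for p x
    using is_lub_upper[OF f] that by blast
  have "f (map2 meet x y) = f x \<sqinter> f y" if l: "length x = ?m" "length y = ?m" for x y
  proof (rule antisym)
    have "below (map2 meet x y) \<subseteq> below x \<inter> below y"
      using l by (auto simp: below_def)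
    then show "f (map2 meet x y) \<sqsubseteq> f x \<sqinter> f y"
      by (intro boundedI f_le le_f) auto
    show "f x \<sqinter> f y \<sqsubseteq> f (map2 meet x y)"
    proof (rule lub_meet_lub_le[OF D f f])
      fix s t assume "s \<in> (\<lambda>p. p a) ` below x" "t \<in> (\<lambda>p. p a) ` below y"
      then obtain p q where pq: "p \<in> below x" "q \<in> below y" "s = p a" "t = q a"
        by blast
      \<comment> \<open>The meet of a term below \<open>x\<close> and a term below \<open>y\<close>
        is a term below their coordinatewise meet.\<close>
      let ?r = "restrict (\<lambda>xs. p xs \<sqinter> q xs) (tuples n)"
      have "?r \<in> below (map2 meet x y)"
        using pq(1,2) meet_in_terms[of p n q] l tn by (simp add: below_def coboundedI1 coboundedI2)
      then show "s \<sqinter> t \<sqsubseteq> f (map2 meet x y)"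
        using le_f[of ?r] pq a by simp
    qed
  qed
  moreover have "f (map (\<lambda>t. t ! i) ts) = a ! i" if i: "i < n" for i
  proof (rule antisym)
    let ?pr = "restrict (\<lambda>xs. xs ! i) (tuples n)"
    have pr: "?pr \<in> terms n"
      using i by (rule projection_in_terms)
    then have "?pr \<in> below (map (\<lambda>t. t ! i) ts)"
      using tn by (simp add: below_def refl)
    then show "a ! i \<sqsubseteq> f (map (\<lambda>t. t ! i) ts)"
      using le_f[of ?pr] a by simp
    show "f (map (\<lambda>t. t ! i) ts) \<sqsubseteq> a ! i"
    proof (rule f_le)
      fix p assume p: "p \<in> below (map (\<lambda>t. t ! i) ts)"
      \<comment> \<open>On every tuple of \<open>ts\<close> the value of \<open>p\<close> is below
        the \<open>i\<close>-th entry, so meeting with the projection changes nothing there;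
        \<open>eqs\<close> carries this equation over to \<open>a\<close>.\<close>
      let ?r = "restrict (\<lambda>xs. p xs \<sqinter> ?pr xs) (tuples n)"
      have "p a = ?r a"
      proof (rule eqs)
        show "p \<in> terms n" "?r \<in> terms n"
          using p pr meet_in_terms[of p n ?pr] unfolding below_def by blast+
        fix t assume "t \<in> set ts"
        then obtain j where "j < ?m" "t = ts ! j"
          by (auto simp: in_set_conv_nth)
        then show "p t = ?r t"
          using p tn by (auto simp: below_def meet_le_def)
      qed
      then show "p a \<sqsubseteq> a ! i"
        using a by (auto simp: meet_le_def)
    qed
  qed
  ultimately show ?thesis
    by (auto simp: preserves_def tuples_def)
qed

lemma distributive_imp_SDC:
  assumes D: "distributive_semilattice meet"
  shows "semilattice_SDC meet"
  unfolding semilattice_SDC_def SDC_def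
proof (intro allI impI iffI)
  let ?C = "generated_clone {binary_oper meet}"
  fix n :: nat and T :: "'a list set"
  assume T: "T \<subseteq> tuples n \<and> T \<noteq> {}" and closed: "closed_under n T (centralizer ?C)"
  \<comment> \<open>All equations valid on \<open>T\<close>; this is a finite system because there
    are only finitely many \<open>n\<close>-ary terms.\<close>
  define E where "E = {(p, q) \<in> terms n \<times> terms n. \<forall>t\<in>T. p t = q t}"
  have "?C \<subseteq> operations"
    using is_clone_terms by (simp add: is_clone_def)
  then have "finite (terms n \<times> terms n)"
    by (simp add: finite_n_ary)
  moreover have "E \<subseteq> terms n \<times> terms n"
    by (auto simp: E_def)
  ultimately have "equation_system ?C n E"
    unfolding equation_system_def using finite_subset by blast
  have "finite (tuples n :: 'a list set)"
    using finite_lists_length_eq[of "UNIV :: 'a set" n] by (simp add: tuples_def)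
  then have "finite T"
    using T finite_subset by blast
  then obtain ts where ts: "set ts = T"
    using finite_list by blast
  have "a \<in> T" if a: "a \<in> Sol n E" for a
  proof -
    have an: "a \<in> tuples n" and eq: "\<And>p q. (p, q) \<in> E \<Longrightarrow> p a = q a"
      using a by (auto simp: Sol_def)
    then obtain f where f: "preserves meet (length ts) f" "\<And>i. i < n \<Longrightarrow> f (map (\<lambda>t. t ! i) ts) = a ! i"
      using homomorphism_extension[OF D, of ts n a] T ts by (auto simp: E_def)
    let ?f = "restrict f (tuples (length ts))"
    \<comment> \<open>The arity of \<open>?f\<close> is the length of \<open>ts\<close>, which must
      be positive for \<open>?f\<close> to be an operation.\<close>
    have "ts \<noteq> []"
      using T ts by auto
    then have "?f \<in> n_ary (centralizer ?C) (length ts)"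
      using f(1) by (simp add: n_ary_centralizer_binary_oper preserves_restrict Suc_le_eq)
    then have "map (\<lambda>i. ?f (map (\<lambda>t. t ! i) ts)) [0..<n] \<in> T"
      using closed ts unfolding closed_under_def by blast
    moreover have "map (\<lambda>i. ?f (map (\<lambda>t. t ! i) ts)) [0..<n] = a"
      using an f(2) by (intro nth_equalityI) (auto simp: tuples_def)
    ultimately show ?thesis
      by simp
  qed
  moreover have "T \<subseteq> Sol n E"
    using T by (auto simp: Sol_def E_def)
  ultimately show "\<exists>E. equation_system ?C n E \<and> T = Sol n E"
    using \<open>equation_system ?C n E\<close> by blast
qed (use closed_under_Sol in blast)

section \<open>From (SDC) to distributivity\<close>

definition two_valued :: "'a \<Rightarrow> 'a \<Rightarrow> bool \<Rightarrow> 'a" where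
  "two_valued b c P = (if P then c else b)"

lemma meet_two_valued:
  "b \<sqsubseteq> c \<Longrightarrow> two_valued b c P \<sqinter> two_valued b c Q = two_valued b c (P \<and> Q)"
  by (auto simp: two_valued_def meet_le_def commute)

text \<open>
  The rows \<open>r x\<close> form a copy of the semilattice inside the Boolean lattice of \<open>{b, c}\<close>-valued
  tuples. The identity of \<open>'a\<close>, read as a tuple, satisfies every equation that holds in all
  images of the rows, because the maps \<open>x \<mapsto> two_valued b c (y \<sqsubseteq> x)\<close> are homomorphisms that jointly
  separate points.
\<close>

lemma SDC_retraction:
  fixes es :: "'a list"
  assumes S: "semilattice_SDC meet"
    and b: "\<And>x. b \<sqsubseteq> x" and c: "c \<noteq> b"
    and es: "set es = UNIV"
  defines "r \<equiv> \<lambda>x. map (\<lambda>y. two_valued b c (y \<sqsubseteq> x)) es"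
  shows "\<exists>f. preserves meet (length es) f \<and> (\<forall>x. f (r x) = x)"
proof -
  let ?n = "length es"
  let ?C = "generated_clone {binary_oper meet}"
  \<comment> \<open>The tuples of values that homomorphisms can take on the rows. Membership of
    \<open>es\<close> in \<open>T\<close> is exactly the existence of the retraction, and (SDC)
    reduces it to checking equations.\<close>
  define T where "T = {map (\<lambda>x. f (r x)) es | f. preserves meet ?n f}"
  have n: "1 \<le> ?n"
    using es by (cases es) auto
  have nth_hom: "preserves meet ?n (\<lambda>xs. xs ! j)" if "j < ?n" for j
    using that by (auto simp: preserves_def tuples_def)
  have "T \<subseteq> tuples ?n"
    by (auto simp: T_def tuples_def)
  moreover have "T \<noteq> {}"
  proof -
    have "preserves meet ?n (\<lambda>xs. xs ! 0)"
      using n by (intro nth_hom) linarith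
    then show ?thesis
      unfolding T_def by blast
  qed
  moreover have "closed_under ?n T (centralizer ?C)"
    unfolding closed_under_def
  proof (intro allI impI)
    fix m f ts
    assume a: "f \<in> n_ary (centralizer ?C) m \<and> length ts = m \<and> set ts \<subseteq> T"
    then have f: "preserves meet m f"
      by (simp add: n_ary_centralizer_binary_oper)
    have "\<forall>t\<in>set ts. \<exists>g. preserves meet ?n g \<and> t = map (\<lambda>x. g (r x)) es"
      using a by (auto simp: T_def)
    then obtain G where G: "\<And>t. t \<in> set ts \<Longrightarrow> preserves meet ?n (G t)"
        and ts: "\<And>t. t \<in> set ts \<Longrightarrow> t = map (\<lambda>x. G t (r x)) es"
      by metis
    \<comment> \<open>Composing \<open>f\<close> with the homomorphisms that represent the members
      of \<open>ts\<close> gives a homomorphism representing their componentwise image.\<close>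
    let ?g = "\<lambda>xs. f (map (\<lambda>t. G t xs) ts)"
    have "preserves meet ?n ?g"
      unfolding preserves_def
    proof (intro ballI)
      fix xs ys :: "'a list"
      assume l: "xs \<in> tuples ?n" "ys \<in> tuples ?n"
      have "map (\<lambda>t. G t (map2 meet xs ys)) ts = map2 meet (map (\<lambda>t. G t xs) ts) (map (\<lambda>t. G t ys) ts)"
        using G l by (intro nth_equalityI) (auto simp: preserves_def)
      then show "?g (map2 meet xs ys) = ?g xs \<sqinter> ?g ys"
        using preservesD[OF f] a by simp
    qed
    moreover have "map (\<lambda>i. f (map (\<lambda>t. t ! i) ts)) [0..<?n] = map (\<lambda>x. ?g (r x)) es"
    proof (rule nth_equalityI)
      fix i assume "i < length (map (\<lambda>i. f (map (\<lambda>t. t ! i) ts)) [0..<?n])"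
      then have i: "i < ?n"
        by simp
      have "t ! i = G t (r (es ! i))" if "t \<in> set ts" for t
        using arg_cong[OF ts[OF that], of "\<lambda>t. t ! i"] i by simp
      then have "f (map (\<lambda>t. t ! i) ts) = f (map (\<lambda>t. G t (r (es ! i))) ts)"
        by (simp cong: map_cong)
      then show "map (\<lambda>i. f (map (\<lambda>t. t ! i) ts)) [0..<?n] ! i = map (\<lambda>x. ?g (r x)) es ! i"
        using i by simp
    qed simp
    ultimately show "map (\<lambda>i. f (map (\<lambda>t. t ! i) ts)) [0..<?n] \<in> T"
      unfolding T_def by (intro CollectI exI[of _ ?g] conjI)
  qed
  ultimately obtain E where E: "equation_system ?C ?n E" "T = Sol ?n E"
    using S n unfolding semilattice_SDC_def SDC_def by blast
  have "p es = q es" if pq: "(p, q) \<in> E" for p q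
  proof -
    \<comment> \<open>The indicator of the up-set of \<open>y\<close> is a unary homomorphism, hence
      commutes with the term \<open>p\<close>.\<close>
    have hom: "two_valued b c (y \<sqsubseteq> p es) = p (map (\<lambda>x. two_valued b c (y \<sqsubseteq> x)) es)"
      if p: "p \<in> terms ?n" for p y
    proof -
      let ?h = "restrict (\<lambda>xs. two_valued b c (y \<sqsubseteq> xs ! 0)) (tuples 1)"
      have "preserves meet 1 ?h"
        by (rule preserves_restrict)
          (auto simp: preserves_def tuples_def meet_two_valued[OF b] bounded_iff)
      then have "?h \<in> n_ary (centralizer ?C) 1"
        by (simp add: n_ary_centralizer_binary_oper)
      then have "commute (?n, p) (1, ?h)"
        using p by (auto simp: n_ary_def centralizer_def)
      then have "p (map (\<lambda>i. ?h (map (\<lambda>t. t ! i) [es])) [0..<?n]) = ?h (map p [es])"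
        by (rule commute_tuples) (auto simp: tuples_def)
      then show ?thesis
        using map_nth_upt[of "\<lambda>x. two_valued b c (y \<sqsubseteq> x)" es] by (simp add: tuples_def)
    qed
    \<comment> \<open>With \<open>y = es ! j\<close>, the \<open>j\<close>-th coordinates of the
      rows form the indicator image of \<open>es\<close>. This tuple lies in \<open>T\<close>, so
      \<open>p\<close> and \<open>q\<close> agree on it; through \<open>hom\<close>,
      \<open>p es\<close> and \<open>q es\<close> then have the same lower bounds.\<close>
    have "y \<sqsubseteq> p es \<longleftrightarrow> y \<sqsubseteq> q es" for y
    proof -
      obtain j where j: "j < ?n" "es ! j = y"
        using es by (metis UNIV_I in_set_conv_nth)
      have "map (\<lambda>x. r x ! j) es \<in> T"
        unfolding T_def
        by (intro CollectI exI[of _ "\<lambda>xs. xs ! j"] conjI HOL.refl nth_hom j(1))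
      moreover have "map (\<lambda>x. r x ! j) es = map (\<lambda>x. two_valued b c (y \<sqsubseteq> x)) es"
        using j by (simp add: r_def)
      ultimately have "p (map (\<lambda>x. two_valued b c (y \<sqsubseteq> x)) es) = q (map (\<lambda>x. two_valued b c (y \<sqsubseteq> x)) es)"
        using pq E(2) by (auto simp: Sol_def)
      moreover have "p \<in> terms ?n" "q \<in> terms ?n"
        using pq E(1) by (auto simp: equation_system_def)
      ultimately have "two_valued b c (y \<sqsubseteq> p es) = two_valued b c (y \<sqsubseteq> q es)"
        by (simp add: hom)
      then show ?thesis
        using c by (auto simp: two_valued_def split: if_splits)
    qed
    then show ?thesis
      using refl antisym by blast
  qed
  then have "es \<in> T"
    using E(2) by (auto simp: Sol_def tuples_def)
  then obtain f where f: "preserves meet ?n f" "es = map (\<lambda>x. f (r x)) es"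
    unfolding T_def by blast
  have "f (r x) = x" for x
  proof -
    obtain j where "j < ?n" "es ! j = x"
      using es by (metis UNIV_I in_set_conv_nth)
    then show ?thesis
      using f(2) nth_map by metis
  qed
  then show ?thesis
    using f(1) by blast
qed

lemma SDC_imp_distributive:
  assumes S: "semilattice_SDC meet" and card: "CARD('a) \<ge> 2"
  shows "distributive_semilattice meet"
  unfolding distributive_semilattice_def
proof (intro allI impI)
  fix a b0 b1
  assume a: "b0 \<sqinter> b1 \<sqsubseteq> a"
  obtain b where b: "\<And>x. b \<sqsubseteq> x"
    using bottom_exists by blast
  obtain c where c: "c \<noteq> b"
  proof (rule ccontr)
    assume "\<not> thesis"
    then have "(UNIV :: 'a set) = {b}"
      using that by blast
    then show False
      using card by (metis One_nat_def Suc_1 card.empty card_insert_disjoint empty_iff finite.emptyI not_less_eq_eq order_refl)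
  qed
  obtain es :: "'a list" where es: "set es = UNIV"
    using finite_list[OF finite] by blast
  \<comment> \<open>Encodes a predicate on the semilattice as a
    \<open>b\<close>-\<open>c\<close>-valued tuple; the row of \<open>x\<close> is the encoding of
    its down-set.\<close>
  define w where "w P = map (\<lambda>y. two_valued b c (P y)) es" for P
  obtain f where f: "preserves meet (length es) f" "\<And>x. f (w (\<lambda>y. y \<sqsubseteq> x)) = x"
    using SDC_retraction[OF S b c es] unfolding w_def by blast
  have meet_w: "f (w P) \<sqinter> f (w Q) = f (w (\<lambda>y. P y \<and> Q y))" for P Q
  proof -
    have "map2 meet (w P) (w Q) = w (\<lambda>y. P y \<and> Q y)"
      by (rule nth_equalityI) (auto simp: w_def meet_two_valued[OF b])
    then show ?thesis
      using preservesD[OF f(1), of "w P" "w Q"] by (simp add: w_def)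
  qed
  \<comment> \<open>The union of two down-sets encodes the join of two rows, and need not itself be
    a row; \<open>f\<close> preserves order because it preserves meets.\<close>
  have upper: "x \<sqsubseteq> f (w (\<lambda>y. y \<sqsubseteq> a \<or> y \<sqsubseteq> x))" for x
  proof -
    have "x \<sqinter> f (w (\<lambda>y. y \<sqsubseteq> a \<or> y \<sqsubseteq> x)) =
        f (w (\<lambda>y. y \<sqsubseteq> x)) \<sqinter> f (w (\<lambda>y. y \<sqsubseteq> a \<or> y \<sqsubseteq> x))"
      by (simp add: f(2))
    also have "\<dots> = f (w (\<lambda>y. y \<sqsubseteq> x))"
      unfolding meet_w by (intro arg_cong[where f = "\<lambda>P. f (w P)"]) auto
    finally show ?thesis
      by (simp only: meet_le_def[of meet x] f(2))
  qed
  \<comment> \<open>By distributivity of sets, the intersection of the two unions adds to the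
    down-set of \<open>a\<close> only elements below \<open>b0 \<sqinter> b1\<close>, which already
    lie below \<open>a\<close>.\<close>
  have "f (w (\<lambda>y. y \<sqsubseteq> a \<or> y \<sqsubseteq> b0)) \<sqinter> f (w (\<lambda>y. y \<sqsubseteq> a \<or> y \<sqsubseteq> b1)) = f (w (\<lambda>y. y \<sqsubseteq> a))"
    unfolding meet_w
  proof (intro arg_cong[where f = "\<lambda>P. f (w P)"] ext)
    fix y
    show "((y \<sqsubseteq> a \<or> y \<sqsubseteq> b0) \<and> (y \<sqsubseteq> a \<or> y \<sqsubseteq> b1)) = (y \<sqsubseteq> a)"
      using a trans boundedI by blast
  qed
  then show "\<exists>a0 a1. b0 \<sqsubseteq> a0 \<and> b1 \<sqsubseteq> a1 \<and> a = a0 \<sqinter> a1"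
    using upper[of b0] upper[of b1] f(2)[of a] by metis
qed

end

theorem theorem5p5:
  fixes meet :: "'a::finite \<Rightarrow> 'a \<Rightarrow> 'a"
  assumes "semilattice meet"
    and "CARD('a) \<ge> 2"
  shows "semilattice_SDC meet \<longleftrightarrow> distributive_semilattice meet"
proof -
  interpret finite_semilattice meet
    using assms(1) by (rule finite_semilattice.intro)
  show ?thesis
    using SDC_imp_distributive[OF _ assms(2)] distributive_imp_SDC by blast
qed

end
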